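(* No graph containing (as a subgraph) the spider on three legs of length three can be drawn as a great-circle thrackle.
   Context: Graphs are finite, simple and undirected. A thrackle is a drawing of a graph in which no curve (edge) crosses itself and every pair of curves (edges) intersects at exactly one point (so two edges with a common endpoint meet only at that endpoint, and two edges with no common endpoint meet at exactly one point). A great-circle thrackle is a thrackle drawn on the unit sphere $S^2$ whose vertices are represented as (distinct) points of the sphere and whose edges are represented by arcs of great circles joining their endpoints (an arc may be shorter or longer than $\pi$). Great-circle thrackles are assumed to be in general position: no three vertices lie on the same great circle and no two vertices are antipodal. A spider is a tree in which exactly one vertex $v_0$ has degree at least $3$ and all other vertices have degree at most $2$. The degree of $v_0$ is the number of legs of the spider; the length of a leg is the length (number of edges) of the path beginning at a degree-$1$ vertex and terminating at $v_0$. Thus the spider on three legs of length three has $10$ vertices: $z$ and $v_i, w_i, u_i$ for $i=1,2,3$, with edges $zv_1, v_1v_2, v_2v_3, zw_1, w_1w_2, w_2w_3, zu_1, u_1u_2, u_2u_3$. *)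

theory Defs
  imports "HOL-Analysis.Analysis" "Graph_Theory.Graph_Theory"
begin

section \<open>Finite simple graphs, trees and spiders\<close>

text \<open>
  A finite simple undirected graph is a \<^locale>\<open>pair_graph\<close>: a finite, loop-free, symmetric
  relation on a finite vertex set.  The undirected edge joining \<open>u\<close> and \<open>v\<close> is represented by
  both pairs \<open>(u, v)\<close> and \<open>(v, u)\<close>; the degree of a vertex is therefore its out-degree.
\<close>

definition edge_set :: "'a pair_pre_digraph \<Rightarrow> 'a set set" where
  "edge_set G = {{u, v} |u v. (u, v) \<in> parcs G}"

text \<open>
  The library predicate \<open>tree\<close> cannot be used here: it counts \<open>u, v, u\<close> as a cycle, so no
  symmetric digraph with an edge satisfies it.  A cycle of an undirected graph has at least
  three vertices.
\<close>

definition undirected_tree :: "'a pair_pre_digraph \<Rightarrow> bool" where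
  "undirected_tree G \<longleftrightarrow>
     pair_graph G \<and> Digraph_Component.connected (with_proj G) \<and>
     \<not> (\<exists>p. vpath p (with_proj G) \<and> 3 \<le> length p \<and> (last p, hd p) \<in> parcs G)"

definition spider :: "'a pair_pre_digraph \<Rightarrow> 'a \<Rightarrow> bool" where
  "spider G z \<longleftrightarrow>
     undirected_tree G \<and> z \<in> pverts G \<and> 3 \<le> out_degree (with_proj G) z \<and>
     (\<forall>v \<in> pverts G. v \<noteq> z \<longrightarrow> out_degree (with_proj G) v \<le> 2)"

definition spider_legs :: "'a pair_pre_digraph \<Rightarrow> 'a \<Rightarrow> 'a vwalk set" where
  "spider_legs G z =
     {p. vpath p (with_proj G) \<and> out_degree (with_proj G) (hd p) = 1 \<and> last p = z}"

definition spider_on_legs :: "nat \<Rightarrow> nat \<Rightarrow> 'a pair_pre_digraph \<Rightarrow> bool" where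
  "spider_on_legs k l G \<longleftrightarrow>
     (\<exists>z. spider G z \<and> out_degree (with_proj G) z = k \<and>
          (\<forall>p \<in> spider_legs G z. vwalk_length p = l))"


section \<open>Great-circle thrackles\<close>

definition great_circle :: "(real ^ 3) set \<Rightarrow> bool" where
  "great_circle C \<longleftrightarrow> (\<exists>n. n \<noteq> 0 \<and> C = {x \<in> sphere 0 1. n \<bullet> x = 0})"

text \<open>
  \<open>great_circle_arc p q A\<close>: starting at \<open>p\<close> in the unit tangent direction \<open>u\<close>, the arc \<open>A\<close> runs
  along a great circle for a length \<open>l\<close> and ends at \<open>q\<close>.  The length may exceed \<open>pi\<close>; since
  \<open>l < 2 * pi\<close>, the parametrisation is injective, so an arc never meets itself.  For distinct
  non-antipodal \<open>p\<close> and \<open>q\<close> there are exactly two such arcs.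
\<close>

definition great_circle_arc :: "real ^ 3 \<Rightarrow> real ^ 3 \<Rightarrow> (real ^ 3) set \<Rightarrow> bool" where
  "great_circle_arc p q A \<longleftrightarrow>
     (\<exists>u l. norm p = 1 \<and> norm u = 1 \<and> p \<bullet> u = 0 \<and> 0 < l \<and> l < 2 * pi \<and>
            q = cos l *\<^sub>R p + sin l *\<^sub>R u \<and>
            A = (\<lambda>t. cos t *\<^sub>R p + sin t *\<^sub>R u) ` {0..l})"

lemma great_circle_arc_sym:
  assumes "great_circle_arc p q A"
  shows "great_circle_arc q p A"
proof -
  obtain u l where p: "norm p = 1" and u: "norm u = 1" and pu: "p \<bullet> u = 0"
    and l: "0 < l" "l < 2 * pi" and q: "q = cos l *\<^sub>R p + sin l *\<^sub>R u"
    and A: "A = (\<lambda>t. cos t *\<^sub>R p + sin t *\<^sub>R u) ` {0..l}"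
    using assms unfolding great_circle_arc_def by blast
  define w where "w = sin l *\<^sub>R p - cos l *\<^sub>R u"
  have pp: "p \<bullet> p = 1" "u \<bullet> u = 1" "u \<bullet> p = 0"
    using p u pu by (simp_all add: norm_eq_1 inner_commute)
  have sc: "sin l * sin l + cos l * cos l = 1"
    using sin_cos_squared_add[of l] by (simp add: power2_eq_square)
  have rev: "cos t *\<^sub>R q + sin t *\<^sub>R w = cos (l - t) *\<^sub>R p + sin (l - t) *\<^sub>R u" for t
    unfolding q w_def by (simp add: cos_diff sin_diff algebra_simps)
  have "norm q = 1" "norm w = 1"
    using sc unfolding q w_def norm_eq_1
    by (simp_all add: inner_add_left inner_add_right inner_diff_left inner_diff_right pp pu)
  moreover have "q \<bullet> w = 0"
    unfolding q w_def
    by (simp add: inner_add_left inner_add_right inner_diff_left inner_diff_right pp pu)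
  moreover have "p = cos l *\<^sub>R q + sin l *\<^sub>R w"
    by (simp add: rev)
  moreover have "A = (\<lambda>t. cos t *\<^sub>R q + sin t *\<^sub>R w) ` {0..l}"
  proof -
    have "{0..l} = (\<lambda>t. l - t) ` {0..l}" by simp
    then show ?thesis unfolding A rev by (metis (no_types, lifting) image_cong image_image)
  qed
  ultimately show ?thesis
    unfolding great_circle_arc_def using l by blast
qed

definition spherical_general_position :: "('a \<Rightarrow> real ^ 3) \<Rightarrow> 'a set \<Rightarrow> bool" where
  "spherical_general_position pos V \<longleftrightarrow>
     (\<forall>u \<in> V. \<forall>v \<in> V. \<forall>w \<in> V. u \<noteq> v \<and> v \<noteq> w \<and> u \<noteq> w \<longrightarrow>
        \<not> (\<exists>C. great_circle C \<and> {pos u, pos v, pos w} \<subseteq> C)) \<and>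
     (\<forall>u \<in> V. \<forall>v \<in> V. pos u \<noteq> - pos v)"

text \<open>
  \<open>pos\<close> places the vertices and \<open>curve\<close> gives the point set of each edge.  Arcs contain their
  endpoints, so the only common point of two adjacent edges is their common endpoint.  By general
  position, no edge passes through a vertex other than its endpoints, and edges without a common
  endpoint meet in a proper crossing.
\<close>

definition great_circle_thrackle ::
  "'a pair_pre_digraph \<Rightarrow> ('a \<Rightarrow> real ^ 3) \<Rightarrow> ('a set \<Rightarrow> (real ^ 3) set) \<Rightarrow> bool" where
  "great_circle_thrackle G pos curve \<longleftrightarrow>
     pos ` pverts G \<subseteq> sphere 0 1 \<and> inj_on pos (pverts G) \<and>
     spherical_general_position pos (pverts G) \<and>
     (\<forall>u v. (u, v) \<in> parcs G \<longrightarrow> great_circle_arc (pos u) (pos v) (curve {u, v})) \<and>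
     (\<forall>e \<in> edge_set G. \<forall>f \<in> edge_set G. e \<noteq> f \<longrightarrow> (\<exists>!x. x \<in> curve e \<inter> curve f))"

end

theory Submission
  imports Defs
begin

text \<open>
  An edge is long if its arc exceeds a half circle.  By general position, everything is encoded in
  the signs of the triple products of the vertices and in the set of long edges; two edges with a
  common end are not both long, since both would pass through its antipode.

  Let \<open>z a c d\<close> be a leg of the spider and \<open>z b\<close> the first edge of another leg.  Crossing the leg
  determines the side of the great circle of \<open>z a\<close> on which \<open>z b\<close> departs: the sign of \<open>[z, a, b]\<close> is
  that of \<open>[z, a, c]\<close>, reversed once for each of \<open>a c\<close> and \<open>z b\<close> that is long.  So for each \<open>a\<close> there is
  a sign \<open>\<tau> a\<close> such that \<open>sgn [z, a, b] = \<tau> a * \<lambda> b\<close> for the two other neighbours \<open>b\<close>, where \<open>\<lambda> b\<close>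
  is \<open>-1\<close> if \<open>z b\<close> is long and \<open>1\<close> otherwise.  For three legs, the product of the six numbers
  \<open>sgn [z, a, b]\<close> is a product of squares by this formula, but \<open>-1\<close> by antisymmetry.
\<close>

section \<open>Triple products and crossings\<close>

text \<open>The determinant of three vectors. For points of the sphere it vanishes iff they lie on a
  common great circle; otherwise its sign is the side of the oriented great circle of
  \<open>a b\<close> on which \<open>c\<close> lies.\<close>

definition tri :: "real ^ 3 \<Rightarrow> real ^ 3 \<Rightarrow> real ^ 3 \<Rightarrow> real" where
  "tri a b c = a \<bullet> cross3 b c"

text \<open>
  Coefficients of the points \<open>s p + t q\<close> on the arc from \<open>p\<close> to \<open>q\<close>: the short arc is the convex
  side, and the long one is the rest of the great circle, endpoints included.
\<close>

definition in_cone :: "bool \<Rightarrow> real \<Rightarrow> real \<Rightarrow> bool" where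
  "in_cone L s t \<longleftrightarrow> L \<and> \<not> (0 < s \<and> 0 < t) \<or> \<not> L \<and> 0 \<le> s \<and> 0 \<le> t"

text \<open>
  In the linear dependency \<open>\<alpha> a + \<beta> b + \<gamma> c + \<delta> d = 0\<close> of four vectors, Cramer's rule gives
  \<open>\<alpha> = tri b c d\<close>, \<open>\<beta> = - tri a c d\<close>, \<open>\<gamma> = tri a b d\<close> and \<open>\<delta> = - tri a b c\<close>.  The great circles of \<open>a b\<close>
  and \<open>c d\<close> meet in the directions \<open>\<plusminus> (\<alpha> a + \<beta> b) = \<minusplus> (\<gamma> c + \<delta> d)\<close>.
\<close>

definition crosses ::
  "bool \<Rightarrow> real ^ 3 \<Rightarrow> real ^ 3 \<Rightarrow> bool \<Rightarrow> real ^ 3 \<Rightarrow> real ^ 3 \<Rightarrow> bool" where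
  "crosses L a b M c d \<longleftrightarrow>
     (in_cone L (tri b c d) (- tri a c d) \<and> in_cone M (- tri a b d) (tri a b c)) \<or>
     (in_cone L (- tri b c d) (tri a c d) \<and> in_cone M (tri a b d) (- tri a b c))"

text \<open>The Grassmann--Pluecker relation, read on signs, for nonzero factors.\<close>

lemma three_term_signs:
  fixes x y v w s t :: real
  assumes "x * y - v * w + s * t = 0" "x \<noteq> 0" "y \<noteq> 0" "v \<noteq> 0" "w \<noteq> 0" "s \<noteq> 0" "t \<noteq> 0"
  shows "((0 < x \<longleftrightarrow> 0 < y) \<or> \<not> (0 < v \<longleftrightarrow> 0 < w) \<or> (0 < s \<longleftrightarrow> 0 < t)) \<and>
    (\<not> (0 < x \<longleftrightarrow> 0 < y) \<or> (0 < v \<longleftrightarrow> 0 < w) \<or> \<not> (0 < s \<longleftrightarrow> 0 < t))"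
proof -
  have "0 < x * y \<longleftrightarrow> (0 < x \<longleftrightarrow> 0 < y)" "0 < v * w \<longleftrightarrow> (0 < v \<longleftrightarrow> 0 < w)"
    "0 < s * t \<longleftrightarrow> (0 < s \<longleftrightarrow> 0 < t)" "x * y \<noteq> 0" "v * w \<noteq> 0" "s * t \<noteq> 0"
    using assms by (auto simp: zero_less_mult_iff)
  \<comment> \<open>The summands \<open>x * y\<close>, \<open>- (v * w)\<close> and
    \<open>s * t\<close> are nonzero with sum zero, so they cannot all have the same sign.\<close>
  with assms(1) show ?thesis by argo
qed

text \<open>
  \<open>L1\<close>, \<open>L2\<close>, \<open>L3\<close>, \<open>L4\<close>, \<open>L5\<close> tell which of the edges \<open>z a\<close>, \<open>a c\<close>, \<open>c d\<close>, \<open>z b\<close>, \<open>b e\<close> are long.  The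
  three-term relations are needed only when both \<open>a c\<close> and \<open>z b\<close> are long.
\<close>

lemma leg_side:
  assumes nz: "tri z a b \<noteq> 0" "tri z a c \<noteq> 0" "tri z a d \<noteq> 0" "tri z a e \<noteq> 0" "tri z c d \<noteq> 0"
    "tri z b c \<noteq> 0" "tri z b d \<noteq> 0" "tri z b e \<noteq> 0" "tri a c d \<noteq> 0" "tri a b c \<noteq> 0" "tri a b d \<noteq> 0"
    "tri a b e \<noteq> 0" "tri a c e \<noteq> 0" "tri b c d \<noteq> 0" "tri b c e \<noteq> 0" "tri b d e \<noteq> 0" "tri c d e \<noteq> 0"
    and adj: "\<not> (L1 \<and> L2)" "\<not> (L2 \<and> L3)" "\<not> (L1 \<and> L4)" "\<not> (L4 \<and> L5)"
    and cr: "crosses L1 z a L3 c d" "crosses L1 z a L5 b e" "crosses L4 z b L2 a c"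
      "crosses L4 z b L3 c d" "crosses L5 b e L2 a c" "crosses L5 b e L3 c d"
  shows "0 < tri z a b \<longleftrightarrow> (0 < tri z a c \<longleftrightarrow> (L2 \<longleftrightarrow> L4))"
proof -
  have reorder: "tri a b z = tri z a b" "tri z b a = - tri z a b" "tri z c b = - tri z b c"
    "tri z d b = - tri z b d" "tri b a c = - tri a b c" "tri a c b = - tri a b c"
    "tri b a e = - tri a b e" "tri e a c = tri a c e" "tri b e c = - tri b c e"
    "tri e c d = tri c d e" "tri b e d = - tri b d e" "tri b e a = tri a b e"
    by (auto simp: tri_def cross3_simps)
  \<comment> \<open>Each of \<open>z\<close>, \<open>a\<close>, \<open>b\<close>, \<open>c\<close>,
    \<open>d\<close> in turn is the common vector, and the other four are split into pairs.\<close>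
  have pluecker: "tri z a b * tri z c d - tri z a c * tri z b d + tri z a d * tri z b c = 0"
     "tri z a b * tri a c d - tri z a c * tri a b d + tri z a d * tri a b c = 0"
     "tri z a b * tri b c d - tri z b c * tri a b d + tri z b d * tri a b c = 0"
     "tri z a c * tri b c d - tri z b c * tri a c d + tri z c d * tri a b c = 0"
     "tri z a d * tri b c d - tri z b d * tri a c d + tri z c d * tri a b d = 0"
    by (simp_all add: tri_def cross3_simps)
  note signs = pluecker[THEN three_term_signs, simplified nz simp_thms]
  \<comment> \<open>As no triple product vanishes, every inequality is a truth value
    \<open>0 < x\<close> or its negation, and the claim becomes propositional.\<close>
  have nonneg: "0 \<le> x \<longleftrightarrow> 0 < x" "0 \<le> - x \<longleftrightarrow> \<not> 0 < x" "0 < - x \<longleftrightarrow> \<not> 0 < x" if "x \<noteq> 0" for x :: real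
    using that by auto
  show ?thesis
    using adj cr signs unfolding crosses_def in_cone_def reorder minus_minus
    by (simp only: nonneg nz simp_thms) sat
qed


section \<open>Great-circle arcs as cones\<close>

text \<open>Read off the point set, hence independent of the direction of traversal. An arc contains
  an antipodal pair iff its length is at least \<pi>, and length \<pi> would make the endpoints
  antipodal.\<close>

definition is_long :: "(real ^ 3) set \<Rightarrow> bool" where
  "is_long A \<longleftrightarrow> (\<exists>x\<in>A. - x \<in> A)"

lemma great_circle_arc_endpoint: "great_circle_arc p q A \<Longrightarrow> p \<in> A"
  unfolding great_circle_arc_def by (auto intro!: image_eqI[where x = 0])

lemma great_circle_arc_norm:
  assumes "great_circle_arc p q A" "x \<in> A"
  shows "norm x = 1"
proof -
  obtain u t where "norm p = 1" "norm u = 1" "p \<bullet> u = 0" "x = cos t *\<^sub>R p + sin t *\<^sub>R u"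
    using assms unfolding great_circle_arc_def by blast
  then show ?thesis
    using sin_cos_squared_add2[of t]
    by (simp add: norm_eq_1 inner_add_left inner_add_right inner_commute power2_eq_square)
qed

text \<open>Eliminating the tangent vector gives the point at distance \<open>t\<close> the
  coefficients \<open>sin (l - t) / sin l\<close> and \<open>sin t / sin l\<close>. If
  \<open>l < pi\<close>, both are nonnegative. If \<open>l > pi\<close>, then
  \<open>sin l < 0\<close>, and \<open>t\<close> and \<open>l - t\<close> do not both exceed \<pi>,
  so some coefficient is at most 0.\<close>

lemma great_circle_arc_cases:
  assumes "great_circle_arc p q A" "q \<noteq> - p"
  shows "(is_long A \<longrightarrow> - p \<in> A) \<and>
    (\<forall>x\<in>A. \<exists>s t. x = s *\<^sub>R p + t *\<^sub>R q \<and> in_cone (is_long A) s t)"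
proof -
  obtain u l where p: "norm p = 1" and u: "norm u = 1" and pu: "p \<bullet> u = 0"
    and l: "0 < l" "l < 2 * pi" and q: "q = cos l *\<^sub>R p + sin l *\<^sub>R u"
    and A: "A = (\<lambda>t. cos t *\<^sub>R p + sin t *\<^sub>R u) ` {0..l}"
    using assms(1) unfolding great_circle_arc_def by blast
  have "l \<noteq> pi"
    using q assms(2) by auto
  have coords: "a = c \<and> b = d" if "a *\<^sub>R p + b *\<^sub>R u = c *\<^sub>R p + d *\<^sub>R u" for a b c d
    using arg_cong[OF that, of "\<lambda>x. p \<bullet> x"] arg_cong[OF that, of "\<lambda>x. u \<bullet> x"] p u pu
    by (auto simp: inner_add_right inner_commute[of u p])
  have long: "pi < l" if "is_long A"
  proof (rule ccontr)
    assume "\<not> pi < l"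
    obtain t t' where t: "t \<in> {0..l}" "t' \<in> {0..l}"
      and "- (cos t *\<^sub>R p + sin t *\<^sub>R u) = cos t' *\<^sub>R p + sin t' *\<^sub>R u"
      using \<open>is_long A\<close> unfolding is_long_def A by blast
    then have "(- cos t) *\<^sub>R p + (- sin t) *\<^sub>R u = cos t' *\<^sub>R p + sin t' *\<^sub>R u"
      by simp
    then have "cos t' = - cos t" "sin t' = - sin t"
      using coords by (metis)+
    \<comment> \<open>The cosine of the difference of the parameters is the inner product of the two
      antipodal points.\<close>
    then have "cos \<bar>t - t'\<bar> = - 1"
      using sin_cos_squared_add2[of t] by (simp add: cos_diff power2_eq_square algebra_simps)
    moreover have "\<bar>t - t'\<bar> < pi"
      using t \<open>\<not> pi < l\<close> \<open>l \<noteq> pi\<close> by auto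
    ultimately show False
      using cos_monotone_0_pi[of "\<bar>t - t'\<bar>" pi] by simp
  qed
  have antipode: "- p \<in> A" if "pi < l"
    unfolding A using that by (auto intro!: image_eqI[where x = pi])
  have is_long: "is_long A \<longleftrightarrow> pi < l"
    using long antipode great_circle_arc_endpoint[OF assms(1)] unfolding is_long_def by blast
  have "\<exists>s r. cos t *\<^sub>R p + sin t *\<^sub>R u = s *\<^sub>R p + r *\<^sub>R q \<and> in_cone (is_long A) s r"
    if t: "0 \<le> t" "t \<le> l" for t
  proof -
    have "sin l \<noteq> 0"
      using l \<open>l \<noteq> pi\<close> sin_gt_zero[of l] sin_gt_zero[of "l - pi"] by (force simp: not_less)
    have "cos t *\<^sub>R p + sin t *\<^sub>R u = (sin (l - t) / sin l) *\<^sub>R p + (sin t / sin l) *\<^sub>R q"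
      using \<open>sin l \<noteq> 0\<close> unfolding q by (simp add: sin_diff algebra_simps diff_divide_distrib add_divide_distrib)
    moreover have "in_cone (is_long A) (sin (l - t) / sin l) (sin t / sin l)"
    proof (cases "pi < l")
      case True
      then have "sin l < 0"
        using l by (simp add: sin_lt_zero)
      moreover have "0 \<le> sin t \<or> 0 \<le> sin (l - t)"
        using t l by (cases "t \<le> pi") (auto intro!: sin_ge_zero)
      ultimately show ?thesis
        using True by (auto simp: in_cone_def is_long zero_less_divide_iff)
    next
      case False
      then have "0 < sin l" "0 \<le> sin t" "0 \<le> sin (l - t)"
        using l t \<open>l \<noteq> pi\<close> by (auto intro!: sin_gt_zero sin_ge_zero)
      then show ?thesis
        using False by (simp add: in_cone_def is_long)
    qed
    ultimately show ?thesis by blast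
  qed
  then show ?thesis
    using antipode is_long unfolding A by auto
qed

lemma in_cone_scale: "0 < k \<Longrightarrow> in_cone L (k * s) (k * t) \<longleftrightarrow> in_cone L s t"
  by (simp add: in_cone_def zero_less_mult_iff zero_le_mult_iff)

text \<open>A common point, expanded in \<open>a\<close>, \<open>b\<close> and in \<open>c\<close>,
  \<open>d\<close>, is a linear dependency of the four vectors. Triple products with two of them fix
  its coefficients up to a factor \<open>k\<close>, whose sign selects the disjunct of
  \<open>crosses\<close>.\<close>

lemma arcs_cross:
  assumes "great_circle_arc a b A" "b \<noteq> - a" "great_circle_arc c d B" "d \<noteq> - c"
    and "x \<in> A" "x \<in> B"
    and nz: "tri b c d \<noteq> 0" "tri a c d \<noteq> 0" "tri a b d \<noteq> 0" "tri a b c \<noteq> 0"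
  shows "crosses (is_long A) a b (is_long B) c d"
proof -
  obtain s t where x1: "x = s *\<^sub>R a + t *\<^sub>R b" and A: "in_cone (is_long A) s t"
    using great_circle_arc_cases[OF assms(1,2)] \<open>x \<in> A\<close> by blast
  obtain s' t' where x2: "x = s' *\<^sub>R c + t' *\<^sub>R d" and B: "in_cone (is_long B) s' t'"
    using great_circle_arc_cases[OF assms(3,4)] \<open>x \<in> B\<close> by blast
  have "x \<noteq> 0"
    using great_circle_arc_norm[OF assms(1,5)] by auto
  have e: "s *\<^sub>R a + t *\<^sub>R b = s' *\<^sub>R c + t' *\<^sub>R d"
    using x1 x2 by simp
  have e1: "s * tri a c d + t * tri b c d = 0"
    using arg_cong[OF e, of "\<lambda>x. tri x c d"] by (simp add: tri_def cross3_simps)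
  have e2: "s' * tri a b c + t' * tri a b d = 0"
    using arg_cong[OF e, of "\<lambda>x. tri a b x"] by (simp add: tri_def cross3_simps)
  have e3: "t * tri a b c = - t' * tri a c d"
    using arg_cong[OF e, of "\<lambda>x. tri a x c"] by (simp add: tri_def cross3_simps)
  define k where "k = s / tri b c d"
  have k: "s = k * tri b c d" "t = k * - tri a c d"
    using e1 nz by (simp_all add: k_def field_simps)
  have k': "t' = k * tri a b c"
    using e3 nz unfolding k by (simp add: field_simps)
  have k'': "s' = k * - tri a b d"
  proof -
    have "(s' + k * tri a b d) * tri a b c = 0"
      using e2 unfolding k' by (simp add: algebra_simps)
    then show ?thesis using nz by simp
  qed
  have "k \<noteq> 0"
    using x1 \<open>x \<noteq> 0\<close> unfolding k by auto
  then consider "0 < k" | "0 < - k" by linarith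
  then show ?thesis
  proof cases
    case 1
    then show ?thesis
      using A B unfolding k k' k'' crosses_def by (simp only: in_cone_scale simp_thms)
  next
    case 2
    then show ?thesis
      using A B in_cone_scale[OF 2, of _ "- tri b c d" "tri a c d"]
        in_cone_scale[OF 2, of _ "tri a b d" "- tri a b c"] unfolding k k' k'' crosses_def by simp
  qed
qed

lemma arcs_not_both_long:
  assumes "great_circle_arc a b A" "b \<noteq> - a" "great_circle_arc a c B" "c \<noteq> - a"
    and "\<exists>!x. x \<in> A \<inter> B"
  shows "\<not> (is_long A \<and> is_long B)"
proof
  assume "is_long A \<and> is_long B"
  then have "- a \<in> A \<inter> B" "a \<in> A \<inter> B"
    using great_circle_arc_cases[OF assms(1,2)] great_circle_arc_cases[OF assms(3,4)]
      great_circle_arc_endpoint[OF assms(1)] great_circle_arc_endpoint[OF assms(3)] by blast+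
  then have "a = - a"
    using assms(5) by blast
  moreover have "norm a = 1"
    using great_circle_arc_norm[OF assms(1)] great_circle_arc_endpoint[OF assms(1)] .
  ultimately show False
    by (metis eq_neg_iff_add_eq_0 norm_zero scaleR_2 scaleR_eq_0_iff zero_neq_numeral zero_neq_one)
qed

text \<open>The cross product of two of the points is nonzero by Lagrange's identity, as they are
  neither equal nor antipodal. If the triple product vanished, it would be normal to a great circle
  through all three.\<close>

lemma general_position_tri:
  assumes sph: "pos ` V \<subseteq> sphere 0 1" and inj: "inj_on pos V" and gp: "spherical_general_position pos V"
    and uvw: "u \<in> V" "v \<in> V" "w \<in> V" "u \<noteq> v" "v \<noteq> w" "u \<noteq> w"
  shows "tri (pos u) (pos v) (pos w) \<noteq> 0"
proof
  assume 0: "tri (pos u) (pos v) (pos w) = 0"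
  define n where "n = cross3 (pos v) (pos w)"
  have nm: "norm (pos u) = 1" "norm (pos v) = 1" "norm (pos w) = 1"
    using sph uvw by auto
  have "pos v \<noteq> pos w"
    using inj uvw by (auto dest: inj_onD)
  moreover have "pos v \<noteq> - pos w"
    using gp uvw unfolding spherical_general_position_def by blast
  ultimately have "n \<noteq> 0"
  proof -
    have "(pos v \<bullet> pos w)\<^sup>2 = 1" if "n = 0"
      using norm_cross_dot[of "pos v" "pos w"] that nm by (simp add: n_def)
    moreover have "norm (pos v - pos w) ^ 2 = 2 - 2 * (pos v \<bullet> pos w)"
      "norm (pos v + pos w) ^ 2 = 2 + 2 * (pos v \<bullet> pos w)"
      using nm by (simp_all add: power2_norm_eq_inner norm_eq_1 inner_diff inner_add inner_commute)
    moreover have "norm (pos v - pos w) \<noteq> 0" "norm (pos v + pos w) \<noteq> 0"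
      using \<open>pos v \<noteq> pos w\<close> \<open>pos v \<noteq> - pos w\<close> by (auto simp: add_eq_0_iff2)
    ultimately show ?thesis
      by (auto simp: power2_eq_1_iff)
  qed
  moreover have "n \<bullet> pos u = 0" "n \<bullet> pos v = 0" "n \<bullet> pos w = 0"
    using 0 by (simp_all add: n_def tri_def inner_commute dot_cross_self)
  ultimately have "great_circle {x \<in> sphere 0 1. n \<bullet> x = 0}"
    "{pos u, pos v, pos w} \<subseteq> {x \<in> sphere 0 1. n \<bullet> x = 0}"
    using nm unfolding great_circle_def by auto
  then show False
    using gp uvw unfolding spherical_general_position_def by blast
qed


section \<open>Legs of a spider\<close>

lemma out_degree_with_proj: "out_degree (with_proj G) v = card {w. (v, w) \<in> parcs G}"
proof -
  have "out_arcs (with_proj G) v = Pair v ` {w. (v, w) \<in> parcs G}"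
    by (auto simp: out_arcs_def)
  then show ?thesis
    by (simp add: out_degree_def card_image inj_on_def)
qed

text \<open>Take a longest path beginning with \<open>z\<close>, \<open>v\<close>. A neighbour of
  its last vertex other than the predecessor would close a cycle if it lay on the path, and would
  prolong the path otherwise.\<close>

lemma path_to_leaf:
  assumes G: "undirected_tree G" and zv: "(z, v) \<in> parcs G"
  obtains p where "vpath (z # v # p) (with_proj G)"
    and "out_degree (with_proj G) (last (z # v # p)) = 1"
proof -
  interpret pair_graph G
    using G unfolding undirected_tree_def by blast
  define P where "P p \<longleftrightarrow> vpath (z # v # p) (with_proj G)" for p
  have "P []"
    using zv no_loops' in_arcsD1 in_arcsD2 by (auto simp: P_def vpath_def vwalk_def)
  moreover have "length p < card (pverts G)" if "P p" for p
  proof -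
    have "card (set (z # v # p)) \<le> card (pverts G)"
      using that pair_finite_verts by (intro card_mono) (auto simp: P_def vpath_def vwalk_def)
    then show ?thesis
      using that distinct_card[of "z # v # p"] by (simp add: P_def vpath_def)
  qed
  ultimately obtain p where "P p" and max: "\<And>q. P q \<Longrightarrow> length q \<le> length p"
    using ex_has_greatest_nat[of P "[]" length "card (pverts G)"] by blast
  obtain q y x where q: "z # v # p = q @ [y, x]"
    by (metis append.assoc append_Cons append_Nil append_butlast_last_id list.discI butlast.simps(2))
  have vp: "vpath (q @ [y, x]) (with_proj G)"
    using \<open>P p\<close> by (simp add: P_def q)
  have "w = y" if xw: "(x, w) \<in> parcs G" for w
  proof (rule ccontr)
    assume "w \<noteq> y"
    have "w \<noteq> x" using xw no_loops' by blast
    show False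
    proof (cases "w \<in> set q")
      case True
      then obtain q1 q2 where "q = q1 @ w # q2" by (meson split_list)
      then have "vpath (w # q2 @ [y, x]) (with_proj G)"
        using vp by (auto simp: vpath_def intro: vwalkI_append_r[of _ q1])
      then have "vpath (w # q2 @ [y, x]) (with_proj G) \<and> 3 \<le> length (w # q2 @ [y, x]) \<and>
          (last (w # q2 @ [y, x]), hd (w # q2 @ [y, x])) \<in> parcs G"
        using xw by simp
      then show False
        using G unfolding undirected_tree_def by blast
    next
      case False
      have "vpath ((q @ [y, x]) @ [w]) (with_proj G)"
        using vp xw False \<open>w \<noteq> x\<close> \<open>w \<noteq> y\<close> in_arcsD2[OF xw] set_vwalk_arcs_snoc[of "q @ [y, x]" w]
        by (auto simp: vpath_def vwalk_def)
      then have "P (p @ [w])"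
        unfolding P_def q[symmetric] by simp
      then show False using max by fastforce
    qed
  qed
  moreover have "(y, x) \<in> parcs G"
    using vp vwalkI_append_r[of "[y, x]" q "with_proj G"] by (auto simp: vpath_def vwalk_def)
  ultimately have "{w. (x, w) \<in> parcs G} = {y}"
    using arcs_symmetric by blast
  then have "out_degree (with_proj G) (last (z # v # p)) = 1"
    unfolding q by (simp add: out_degree_with_proj)
  with \<open>P p\<close> show ?thesis
    using that unfolding P_def by blast
qed

lemma spider_leg_vertices:
  assumes "undirected_tree H" "\<forall>p \<in> spider_legs H z. vwalk_length p = 3" "(z, a) \<in> parcs H"
  obtains c d where "vpath [z, a, c, d] (with_proj H)"
proof -
  obtain p where p: "vpath (z # a # p) (with_proj H)"
      "out_degree (with_proj H) (last (z # a # p)) = 1"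
    using path_to_leaf[OF assms(1,3)] .
  have sym: "symmetric (with_proj H)"
    using assms(1) unfolding undirected_tree_def
    by (blast intro: pair_sym_digraph.pair_sym_arcs pair_pseudo_graph.axioms pair_graph.axioms)
  \<comment> \<open>Members of \<open>spider_legs\<close> run from the leaf to
    \<open>z\<close>.\<close>
  have "vpath (rev (z # a # p)) (with_proj H)"
    using p(1) vwalk_rev_ex[OF sym, of "z # a # p"] unfolding vpath_def distinct_rev by blast
  then have "rev (z # a # p) \<in> spider_legs H z"
    using p(2) unfolding spider_legs_def by (simp add: hd_rev hd_append split: if_splits)
  then have "length p = 2"
    using assms(2) by fastforce
  then obtain c d where "p = [c, d]"
    by (auto simp: length_Suc_conv numeral_2_eq_2)
  with p(1) that show ?thesis by blast
qed

text \<open>Each coincidence of vertices of the two legs would close a cycle through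
  \<open>z\<close>.\<close>

lemma two_legs_disjoint:
  assumes G: "undirected_tree G" and a: "vpath [z, a, c, d] (with_proj G)"
    and b: "vpath [z, b, e, f] (with_proj G)" and "a \<noteq> b"
  shows "distinct [z, a, c, d, b, e]"
proof -
  interpret pair_graph G
    using G unfolding undirected_tree_def by blast
  have no_cycle: "\<not> (vpath p (with_proj G) \<and> 3 \<le> length p \<and> (last p, hd p) \<in> parcs G)" for p
    using G unfolding undirected_tree_def by blast
  have arcs: "(z, a) \<in> parcs G" "(a, c) \<in> parcs G" "(c, d) \<in> parcs G" "(z, b) \<in> parcs G" "(b, e) \<in> parcs G"
    and V: "{z, a, c, d, b, e} \<subseteq> pverts G"
    and dist: "distinct [z, a, c, d]" "distinct [z, b, e]"
    using a b by (auto simp: vpath_def vwalk_def)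
  have sym: "(c, a) \<in> parcs G" "(a, z) \<in> parcs G" "(d, c) \<in> parcs G" "(b, z) \<in> parcs G" "(e, b) \<in> parcs G"
    using arcs arcs_symmetric by auto
  have "b \<noteq> c"
    using no_cycle[of "[z, a, c]"] arcs sym V dist by (auto simp: vpath_def vwalk_def)
  moreover have "b \<noteq> d"
    using no_cycle[of "[z, a, c, d]"] arcs sym V dist by (auto simp: vpath_def vwalk_def)
  moreover have "e \<noteq> a"
    using no_cycle[of "[z, b, a]"] arcs sym V dist by (auto simp: vpath_def vwalk_def)
  moreover have "e \<noteq> c"
    using no_cycle[of "[z, a, c, b]"] arcs sym V dist \<open>b \<noteq> c\<close> \<open>a \<noteq> b\<close> by (auto simp: vpath_def vwalk_def)
  moreover have "e \<noteq> d"
    using no_cycle[of "[z, a, c, d, b]"] arcs sym V dist \<open>b \<noteq> c\<close> \<open>b \<noteq> d\<close> \<open>a \<noteq> b\<close> by (auto simp: vpath_def vwalk_def)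
  ultimately show ?thesis
    using dist \<open>a \<noteq> b\<close> by auto
qed


section \<open>Legs in a thrackle\<close>

lemma thrackle_tri_nonzero:
  assumes "great_circle_thrackle G pos curve"
    and "u \<in> pverts G" "v \<in> pverts G" "w \<in> pverts G" "u \<noteq> v" "v \<noteq> w" "u \<noteq> w"
  shows "tri (pos u) (pos v) (pos w) \<noteq> 0"
proof (rule general_position_tri[OF _ _ _ assms(2-)])
  show "pos ` pverts G \<subseteq> sphere 0 1" "inj_on pos (pverts G)"
    "spherical_general_position pos (pverts G)"
    using assms(1) by (simp_all add: great_circle_thrackle_def)
qed

lemma thrackle_leg_side:
  assumes G: "pair_graph G" and thr: "great_circle_thrackle G pos curve"
    and dist: "distinct [z, a, c, d, b, e]"
    and arcs: "(z, a) \<in> parcs G" "(a, c) \<in> parcs G" "(c, d) \<in> parcs G" "(z, b) \<in> parcs G" "(b, e) \<in> parcs G"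
  shows "0 < tri (pos z) (pos a) (pos b) \<longleftrightarrow> (0 < tri (pos z) (pos a) (pos c) \<longleftrightarrow>
    (is_long (curve {a, c}) \<longleftrightarrow> is_long (curve {z, b})))"
proof -
  interpret pair_graph G by fact
  have V: "{z, a, c, d, b, e} \<subseteq> pverts G"
    using arcs by (auto dest: in_arcsD1 in_arcsD2)
  have tri: "tri (pos u) (pos v) (pos w) \<noteq> 0"
    if "{u, v, w} \<subseteq> {z, a, c, d, b, e}" "u \<noteq> v" "v \<noteq> w" "u \<noteq> w" for u v w
    using that V by (intro thrackle_tri_nonzero[OF thr]) auto
  have arc: "great_circle_arc (pos u) (pos v) (curve {u, v})" if "(u, v) \<in> parcs G" for u v
    using thr that by (simp add: great_circle_thrackle_def)
  have anti: "pos v \<noteq> - pos u" if "(u, v) \<in> parcs G" for u v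
    using thr in_arcsD1[OF that] in_arcsD2[OF that]
    by (simp add: great_circle_thrackle_def spherical_general_position_def)
  have meet: "\<exists>!x. x \<in> curve {u, v} \<inter> curve {u', v'}"
    if "(u, v) \<in> parcs G" "(u', v') \<in> parcs G" "{u, v} \<noteq> {u', v'}" for u v u' v'
  proof -
    have "{u, v} \<in> edge_set G" "{u', v'} \<in> edge_set G"
      using that unfolding edge_set_def by blast+
    moreover have "\<forall>e \<in> edge_set G. \<forall>f \<in> edge_set G. e \<noteq> f \<longrightarrow> (\<exists>!x. x \<in> curve e \<inter> curve f)"
      using thr unfolding great_circle_thrackle_def by (elim conjE)
    ultimately show ?thesis
      using that(3) by (elim ballE impE) auto
  qed
  have adj: "\<not> (is_long (curve {u, v}) \<and> is_long (curve {u, w}))"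
    if "(u, v) \<in> parcs G" "(u, w) \<in> parcs G" "v \<noteq> w" for u v w
    using arcs_not_both_long[OF arc[OF that(1)] anti[OF that(1)] arc[OF that(2)] anti[OF that(2)]
        meet[OF that(1,2)]] that(3) by (simp add: doubleton_eq_iff)
  have cross: "crosses (is_long (curve {u, v})) (pos u) (pos v) (is_long (curve {u', v'})) (pos u') (pos v')"
    if "(u, v) \<in> parcs G" "(u', v') \<in> parcs G" "distinct [u, v, u', v']" "{u, v, u', v'} \<subseteq> {z, a, c, d, b, e}"
    for u v u' v'
  proof -
    have "\<exists>!x. x \<in> curve {u, v} \<inter> curve {u', v'}"
      using that(3) by (intro meet[OF that(1,2)]) (auto simp: doubleton_eq_iff)
    then obtain x where "x \<in> curve {u, v}" "x \<in> curve {u', v'}" by blast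
    then show ?thesis
      using that(3,4)
      by (intro arcs_cross[OF arc[OF that(1)] anti[OF that(1)] arc[OF that(2)] anti[OF that(2)]] tri) auto
  qed
  \<comment> \<open>Reversed arcs put the common endpoint of adjacent edges first, as
    \<open>adj\<close> expects.\<close>
  have sym: "(a, z) \<in> parcs G" "(c, a) \<in> parcs G" "(b, z) \<in> parcs G"
    using arcs arcs_symmetric by auto
  have dist': "distinct [z, a, b, c, d, e]"
    using dist by auto
  show ?thesis
  proof (rule leg_side[where d = "pos d" and e = "pos e" and
        ?L1.0 = "is_long (curve {z, a})" and ?L3.0 = "is_long (curve {c, d})" and
        ?L5.0 = "is_long (curve {b, e})"])
    show "\<not> (is_long (curve {z, a}) \<and> is_long (curve {a, c}))"
      using adj[OF sym(1) arcs(2)] dist by (auto simp: insert_commute)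
    show "\<not> (is_long (curve {a, c}) \<and> is_long (curve {c, d}))"
      using adj[OF sym(2) arcs(3)] dist by (auto simp: insert_commute)
    show "\<not> (is_long (curve {z, a}) \<and> is_long (curve {z, b}))"
      using adj[OF arcs(1) arcs(4)] dist by (auto simp: insert_commute)
    show "\<not> (is_long (curve {z, b}) \<and> is_long (curve {b, e}))"
      using adj[OF sym(3) arcs(5)] dist by (auto simp: insert_commute)
    show "tri (pos z) (pos a) (pos b) \<noteq> 0" "tri (pos z) (pos a) (pos c) \<noteq> 0"
      "tri (pos z) (pos a) (pos d) \<noteq> 0" "tri (pos z) (pos a) (pos e) \<noteq> 0"
      "tri (pos z) (pos c) (pos d) \<noteq> 0" "tri (pos z) (pos b) (pos c) \<noteq> 0"
      "tri (pos z) (pos b) (pos d) \<noteq> 0" "tri (pos z) (pos b) (pos e) \<noteq> 0"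
      "tri (pos a) (pos c) (pos d) \<noteq> 0" "tri (pos a) (pos b) (pos c) \<noteq> 0"
      "tri (pos a) (pos b) (pos d) \<noteq> 0" "tri (pos a) (pos b) (pos e) \<noteq> 0"
      "tri (pos a) (pos c) (pos e) \<noteq> 0" "tri (pos b) (pos c) (pos d) \<noteq> 0"
      "tri (pos b) (pos c) (pos e) \<noteq> 0" "tri (pos b) (pos d) (pos e) \<noteq> 0"
      "tri (pos c) (pos d) (pos e) \<noteq> 0"
      using dist' by (simp_all add: tri)
    show "crosses (is_long (curve {z, a})) (pos z) (pos a) (is_long (curve {c, d})) (pos c) (pos d)"
      using dist arcs by (intro cross) auto
    show "crosses (is_long (curve {z, a})) (pos z) (pos a) (is_long (curve {b, e})) (pos b) (pos e)"
      using dist arcs by (intro cross) auto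
    show "crosses (is_long (curve {z, b})) (pos z) (pos b) (is_long (curve {a, c})) (pos a) (pos c)"
      using dist arcs by (intro cross) auto
    show "crosses (is_long (curve {z, b})) (pos z) (pos b) (is_long (curve {c, d})) (pos c) (pos d)"
      using dist arcs by (intro cross) auto
    show "crosses (is_long (curve {b, e})) (pos b) (pos e) (is_long (curve {a, c})) (pos a) (pos c)"
      using dist arcs by (intro cross) auto
    show "crosses (is_long (curve {b, e})) (pos b) (pos e) (is_long (curve {c, d})) (pos c) (pos d)"
      using dist arcs by (intro cross) auto
  qed
qed

theorem corollary3p3:
  fixes G H :: "'a pair_pre_digraph"
  assumes "pair_graph G"
    and "spider_on_legs 3 3 H"
    and "subgraph (with_proj H) (with_proj G)"
  shows "\<not> (\<exists>pos curve. great_circle_thrackle G pos curve)"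
proof
  assume "\<exists>pos curve. great_circle_thrackle G pos curve"
  then obtain pos curve where thr: "great_circle_thrackle G pos curve" by blast
  have sub: "parcs H \<subseteq> parcs G"
    using assms(3) by (simp add: subgraph_def)
  obtain z where tree: "undirected_tree H" and deg: "card {v. (z, v) \<in> parcs H} = 3"
    and legs: "\<forall>p \<in> spider_legs H z. vwalk_length p = 3"
    using assms(2) unfolding spider_on_legs_def spider_def out_degree_with_proj by blast
  obtain v w u where v: "(z, v) \<in> parcs H" and w: "(z, w) \<in> parcs H" and u: "(z, u) \<in> parcs H"
    and ne: "v \<noteq> w" "v \<noteq> u" "w \<noteq> u"
    using deg by (auto simp: card_3_iff)
  have "\<exists>c d. vpath [z, a, c, d] (with_proj H)" if "(z, a) \<in> parcs H" for a
    using spider_leg_vertices[OF tree legs that] by metis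
  then obtain c d where leg: "\<And>a. (z, a) \<in> parcs H \<Longrightarrow> vpath [z, a, c a, d a] (with_proj H)"
    by metis
  have side: "0 < tri (pos z) (pos a) (pos b) \<longleftrightarrow> (0 < tri (pos z) (pos a) (pos (c a)) \<longleftrightarrow>
      (is_long (curve {a, c a}) \<longleftrightarrow> is_long (curve {z, b})))"
    if "(z, a) \<in> parcs H" "(z, b) \<in> parcs H" "a \<noteq> b" for a b
  proof (rule thrackle_leg_side[OF assms(1) thr])
    show "distinct [z, a, c a, d a, b, c b]"
      using two_legs_disjoint[OF tree leg[OF that(1)] leg[OF that(2)] that(3)] .
    show "(z, a) \<in> parcs G" "(a, c a) \<in> parcs G" "(c a, d a) \<in> parcs G" "(z, b) \<in> parcs G"
      "(b, c b) \<in> parcs G"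
      using leg[OF that(1)] leg[OF that(2)] sub by (auto simp: vpath_def vwalk_def)
  qed
  have anti: "0 < tri (pos z) (pos b) (pos a) \<longleftrightarrow> \<not> 0 < tri (pos z) (pos a) (pos b)"
    if "(z, a) \<in> parcs H" "(z, b) \<in> parcs H" "a \<noteq> b" for a b
  proof -
    interpret pair_graph G by fact
    have "{z, a, b} \<subseteq> pverts G" "z \<noteq> a" "z \<noteq> b"
      using that(1,2)[THEN subsetD[OF sub]] no_loops' by (auto dest: in_arcsD1 in_arcsD2)
    then have "tri (pos z) (pos a) (pos b) \<noteq> 0"
      using thrackle_tri_nonzero[OF thr, of z a b] \<open>a \<noteq> b\<close> by simp
    moreover have "tri (pos z) (pos b) (pos a) = - tri (pos z) (pos a) (pos b)"
      by (simp add: tri_def cross3_simps)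
    ultimately show ?thesis by linarith
  qed
  \<comment> \<open>A parity count: in the six instances of \<open>side\<close>, every term on the
    right occurs twice, so an even number of the six signs are negative; by \<open>anti\<close>
    exactly three are.\<close>
  show False
    using side[OF v w ne(1)] side[OF v u ne(2)] side[OF w u ne(3)]
      side[OF w v ne(1)[symmetric]] side[OF u v ne(2)[symmetric]] side[OF u w ne(3)[symmetric]]
      anti[OF v w ne(1)] anti[OF v u ne(2)] anti[OF w u ne(3)]
    by sat
qed

end
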